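(* Let $0<\ell<1$. Then for all $p\in(p_{\min},p_{\max})$, $$\zeta_p=p\,\zeta_0'+p\int_0^p\frac{D_s-3}{s^2}\,ds,$$ where $D_s=3-\zeta_s+s\,\zeta_s'$ and $\zeta_s'=\frac{d}{ds}\zeta_s$.
   Context: $\delta_\ell \mathbf u$ denotes the velocity increment of a field $\mathbf u$ at the fixed scale $\ell$, and $\langle\cdot\rangle$ is an average, i.e. integration against a probability measure. For $p\in\mathbb R$, $\zeta_p:=\log_\ell\langle|\delta_\ell \mathbf u|^p\rangle$, so that $\zeta_0=0$. Put $p_{\min}=\inf\{p\le 0:\zeta_p\text{ is finite}\}$ and $p_{\max}=\sup\{p\ge0:\zeta_p\text{ is finite}\}$. On $(p_{\min},p_{\max})$ the function $p\mapsto\zeta_p$ is concave and smooth, with $\zeta_p'=\langle|\delta_\ell\mathbf u|^p\log_\ell|\delta_\ell\mathbf u|\rangle/\langle|\delta_\ell\mathbf u|^p\rangle$. *)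

theory Defs
  imports "HOL-Probability.Probability"
begin

(* x^p for x >= 0, with 0^p = \<infinity> for p < 0 and 0^0 = 1.  The library's powr cannot be used
   at x = 0, where it is always 0. *)
definition epow :: "real \<Rightarrow> real \<Rightarrow> ennreal" where
  "epow x p = (if p = 0 then 1
               else if x = 0 then (if p > 0 then 0 else \<infinity>)
               else ennreal (x powr p))"

(* The logarithm to a base 0 < l < 1 is decreasing, hence the values at 0 and \<infinity>. *)
definition elog :: "real \<Rightarrow> ennreal \<Rightarrow> ereal" where
  "elog l x = (if x = 0 then \<infinity> else if x = \<infinity> then -\<infinity> else ereal (log l (enn2real x)))"

(* du is the increment at scale l as a random vector under the averaging measure M. *)
definition moment :: "'a measure \<Rightarrow> ('a \<Rightarrow> 'v::real_normed_vector) \<Rightarrow> real \<Rightarrow> ennreal" where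
  "moment M du p = (\<integral>\<^sup>+ w. epow (norm (du w)) p \<partial>M)"

definition ezeta :: "'a measure \<Rightarrow> ('a \<Rightarrow> 'v::real_normed_vector) \<Rightarrow> real \<Rightarrow> real \<Rightarrow> ereal" where
  "ezeta M du l p = elog l (moment M du p)"

definition zeta_dom :: "'a measure \<Rightarrow> ('a \<Rightarrow> 'v::real_normed_vector) \<Rightarrow> real \<Rightarrow> real set" where
  "zeta_dom M du l = {p. \<bar>ezeta M du l p\<bar> \<noteq> \<infinity>}"

definition p_min :: "'a measure \<Rightarrow> ('a \<Rightarrow> 'v::real_normed_vector) \<Rightarrow> real \<Rightarrow> ereal" where
  "p_min M du l = Inf (ereal ` {p \<in> zeta_dom M du l. p \<le> 0})"

definition p_max :: "'a measure \<Rightarrow> ('a \<Rightarrow> 'v::real_normed_vector) \<Rightarrow> real \<Rightarrow> ereal" where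
  "p_max M du l = Sup (ereal ` {p \<in> zeta_dom M du l. p \<ge> 0})"

definition zeta :: "'a measure \<Rightarrow> ('a \<Rightarrow> 'v::real_normed_vector) \<Rightarrow> real \<Rightarrow> real \<Rightarrow> real" where
  "zeta M du l p = real_of_ereal (ezeta M du l p)"

(* The ordinary derivative at interior points of the domain; one-sided at an endpoint. *)
definition zeta' :: "'a measure \<Rightarrow> ('a \<Rightarrow> 'v::real_normed_vector) \<Rightarrow> real \<Rightarrow> real \<Rightarrow> real" where
  "zeta' M du l p = vector_derivative (zeta M du l) (at p within zeta_dom M du l)"

definition D :: "'a measure \<Rightarrow> ('a \<Rightarrow> 'v::real_normed_vector) \<Rightarrow> real \<Rightarrow> real \<Rightarrow> real" where
  "D M du l s = 3 - zeta M du l s + s * zeta' M du l s"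

end

theory Submission
  imports Defs
begin

text \<open>
  Since \<open>D s - 3 = s * \<zeta>'(s) - \<zeta>(s)\<close>, the integrand is the derivative of \<open>\<zeta>(s) / s\<close>. As
  \<open>\<zeta>(0) = 0\<close>, this quotient tends to \<open>\<zeta>'(0)\<close> at 0, so the formula is the fundamental theorem of
  calculus on the open interval between 0 and \<open>p\<close>, multiplied by \<open>p\<close>. The singular
  denominator at 0 leaves integrability to be shown, and this follows from the integrand having
  constant sign (\<open>integral_deriv_quotient\<close>).

  The sign is that of minus a relative entropy. With \<open>m = E[X^s]\<close>, where \<open>X\<close> is the norm of the
  increment, and \<open>Z = X^s / m\<close>, which has mean 1, \<open>ln l * (s * \<zeta>'(s) - \<zeta>(s)) = E[Z * ln Z] \<ge> 0\<close>,
  by \<open>Z * ln Z \<ge> Z - 1\<close> (\<open>relative_entropy_nonneg\<close>); and \<open>ln l < 0\<close>. This takes the place of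
  an appeal to the concavity of \<open>\<zeta>\<close>.

  The regularity of \<open>\<zeta>\<close> comes from the functions \<open>E[X^s * (ln X)^k]\<close>: dominated convergence shows
  that each is the derivative of its predecessor (\<open>has_real_derivative_log_moment\<close>), on any
  open interval at whose endpoints the moments are finite.

  The exponent 0 needs care when \<open>X\<close> vanishes with positive probability. In that case negative
  moments are infinite, and the moments of small positive order tend to the probability of
  \<open>X \<noteq> 0\<close> instead of 1. Hence \<open>\<zeta>\<close> is identified with the logarithm of \<open>E[X powr s]\<close> only away
  from 0, or when some negative moment is finite. Near 0 only the difference quotients of \<open>\<zeta>\<close>
  within its domain enter.
\<close>

section \<open>Differentiating moments in the exponent\<close>

definition log_moment :: "'a measure \<Rightarrow> ('a \<Rightarrow> real) \<Rightarrow> nat \<Rightarrow> real \<Rightarrow> real" where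
  "log_moment M X k s = (\<integral>w. X w powr s * ln (X w) ^ k \<partial>M)"

lemma powr_le_sum_powr:
  fixes x :: real
  assumes "0 \<le> x" "a \<le> s" "s \<le> b"
  shows "x powr s \<le> x powr a + x powr b"
proof (cases "x \<ge> 1")
  case True
  then have "x powr s \<le> x powr b" using assms by (intro powr_mono) auto
  then show ?thesis by (simp add: add_increasing)
next
  case False
  then have "x powr s \<le> x powr a" using assms by (intro powr_mono') auto
  then show ?thesis by (simp add: add_increasing2)
qed

text \<open>
  Powers of the logarithm cost an arbitrarily small change of the exponent, because
  \<open>\<bar>ln x\<bar> ^ k\<close> is at most a multiple of \<open>exp (d * \<bar>ln x\<bar>)\<close>, which for \<open>x > 0\<close> is the larger of
  \<open>x powr d\<close> and \<open>x powr (- d)\<close>. The right-hand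
  side does not depend on \<open>s\<close>, so it serves as the dominating function for all difference
  quotients at once.
\<close>
lemma powr_mult_ln_power_bound:
  fixes x :: real
  assumes "0 \<le> x" "0 < d" "a + d \<le> s" "s \<le> b - d"
  shows "x powr s * \<bar>ln x\<bar> ^ k \<le> (real (Suc k) / d) ^ k * (x powr a + x powr b)"
proof (cases "x = 0")
  case False
  define y where "y = \<bar>ln x\<bar>"
  \<comment> \<open>The exponential is split into \<open>Suc k\<close> equal factors, so that \<open>k\<close> of them can absorb \<open>y ^ k\<close>
    for \<open>k = 0\<close> as well.\<close>
  have y0: "0 \<le> y" by (simp add: y_def)
  have "d * y / Suc k \<le> exp (d * y / Suc k)"
    using exp_ge_add_one_self[of "d * y / Suc k"] by linarith
  then have "y \<le> (real (Suc k) / d) * exp (d * y / Suc k)"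
    using \<open>0 < d\<close> by (simp add: field_simps)
  then have "y ^ k \<le> ((real (Suc k) / d) * exp (d * y / Suc k)) ^ k"
    using y0 by (intro power_mono)
  also have "\<dots> = (real (Suc k) / d) ^ k * exp (k * (d * y / Suc k))"
    by (simp only: power_mult_distrib exp_of_nat_mult)
  also have "\<dots> \<le> (real (Suc k) / d) ^ k * exp (d * y)"
  proof (intro mult_left_mono)
    have "real k * (d * y) \<le> real (Suc k) * (d * y)"
      using y0 \<open>0 < d\<close> by (intro mult_right_mono) auto
    then show "exp (k * (d * y / Suc k)) \<le> exp (d * y)"
      by (simp add: field_simps)
  qed (use \<open>0 < d\<close> in simp)
  finally have "x powr s * y ^ k \<le> x powr s * ((real (Suc k) / d) ^ k * exp (d * y))"
    by (intro mult_left_mono) auto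
  also have "\<dots> = (real (Suc k) / d) ^ k * (x powr s * exp (d * y))"
    by (simp only: ac_simps)
  also have "\<dots> \<le> (real (Suc k) / d) ^ k * (x powr a + x powr b)"
  proof (intro mult_left_mono)
    have "x powr s * exp (d * y) = x powr (if ln x \<ge> 0 then s + d else s - d)"
      using False assms by (auto simp: powr_def y_def exp_add[symmetric] algebra_simps)
    also have "\<dots> \<le> x powr a + x powr b"
      using assms by (intro powr_le_sum_powr) auto
    finally show "x powr s * exp (d * y) \<le> x powr a + x powr b" .
  qed (use \<open>0 < d\<close> in simp)
  finally show ?thesis unfolding y_def .
qed simp

lemma powr_difference_quotient:
  fixes x :: real
  assumes "0 \<le> x" "s \<noteq> t"
  obtains c where "min s t \<le> c" "c \<le> max s t"
    "(x powr t - x powr s) / (t - s) = x powr c * ln x"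
proof (cases "x = 0")
  case True
  then show ?thesis using that[of s] by simp
next
  case False
  then have x: "0 < x" using assms by simp
  have D: "((\<lambda>u. x powr u) has_real_derivative x powr u * ln x) (at u)" for u
    using x by (auto intro!: derivative_eq_intros)
  have "\<exists>c. min s t < c \<and> c < max s t \<and>
      x powr max s t - x powr min s t = (max s t - min s t) * (x powr c * ln x)"
    using assms D by (intro MVT2) auto
  then obtain c where c: "min s t < c" "c < max s t"
      "x powr max s t - x powr min s t = (max s t - min s t) * (x powr c * ln x)" by blast
  show ?thesis
  proof (rule that)
    show "(x powr t - x powr s) / (t - s) = x powr c * ln x"
      using c(3) assms by (cases "s < t") (auto simp: field_simps max_def min_def split: if_splits)
  qed (use c in auto)
qed

text \<open>
  Only the two endpoints \<open>a\<close> and \<open>b\<close> need to be integrable exponents: all that lies strictly between is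
  dominated by them. Since \<open>0 powr s = 0\<close> for every \<open>s\<close>, the set where \<open>X\<close> vanishes contributes
  nothing to any of these integrals.
\<close>
locale moments =
  fixes M :: "'a measure" and X :: "'a \<Rightarrow> real" and a b :: real
  assumes X_measurable [measurable]: "X \<in> borel_measurable M"
    and X_nonneg: "0 \<le> X w"
    and int_a: "integrable M (\<lambda>w. X w powr a)"
    and int_b: "integrable M (\<lambda>w. X w powr b)"
begin

lemma integrable_log_moment:
  assumes "a < s" "s < b"
  shows "integrable M (\<lambda>w. X w powr s * ln (X w) ^ k)"
proof -
  define d where "d = min (s - a) (b - s)"
  show ?thesis
  proof (rule Bochner_Integration.integrable_bound)
    show "integrable M (\<lambda>w. (real (Suc k) / d) ^ k * (X w powr a + X w powr b))"
      using int_a int_b by simp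
    show "AE w in M. norm (X w powr s * ln (X w) ^ k)
        \<le> norm ((real (Suc k) / d) ^ k * (X w powr a + X w powr b))"
    proof (intro AE_I2)
      fix w
      have "X w powr s * \<bar>ln (X w)\<bar> ^ k \<le> (real (Suc k) / d) ^ k * (X w powr a + X w powr b)"
        using assms X_nonneg by (intro powr_mult_ln_power_bound) (auto simp: d_def min_def)
      then show "norm (X w powr s * ln (X w) ^ k)
          \<le> norm ((real (Suc k) / d) ^ k * (X w powr a + X w powr b))"
        unfolding real_norm_def abs_mult[of "X w powr s"] power_abs
        by (intro order_trans[OF _ abs_ge_self]) simp
    qed
  qed simp
qed

lemma integrable_powr:
  assumes "a < s" "s < b"
  shows "integrable M (\<lambda>w. X w powr s)"
  using integrable_log_moment[OF assms, of 0] by simp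

text \<open>
  Dominated convergence along sequences: by the mean value theorem a difference quotient in the
  exponent is \<open>x powr c * ln x\<close> with \<open>c\<close> near \<open>s\<close>, which a single combination of the two endpoint
  powers dominates.
\<close>
lemma has_real_derivative_log_moment:
  assumes "a < s" "s < b"
  shows "(log_moment M X k has_real_derivative log_moment M X (Suc k) s) (at s)"
proof -
  \<comment> \<open>Half of the distance to the endpoints is used for moving the exponent, the other half for
    absorbing the logarithms.\<close>
  define d where "d = min (s - a) (b - s) / 2"
  have d: "0 < d" "a + d \<le> s - d" "s + d \<le> b - d"
    using assms by (auto simp: d_def min_def field_simps)
  define q where "q t w = (X w powr t - X w powr s) / (t - s) * ln (X w) ^ k" for t w
  have quot: "(\<lambda>n. \<integral>w. q (t n) w \<partial>M) \<longlonglongrightarrow> log_moment M X (Suc k) s"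
    if t: "\<And>n. t n \<noteq> s" "\<And>n. \<bar>t n - s\<bar> \<le> d" "t \<longlonglongrightarrow> s" for t :: "nat \<Rightarrow> real"
    unfolding log_moment_def
  proof (rule integral_dominated_convergence)
    show "integrable M (\<lambda>w. (real (Suc (Suc k)) / d) ^ Suc k * (X w powr a + X w powr b))"
      using int_a int_b by simp
    show "AE w in M. (\<lambda>n. q (t n) w) \<longlonglongrightarrow> X w powr s * ln (X w) ^ Suc k"
    proof (intro AE_I2)
      fix w
      have "((\<lambda>u. X w powr u) has_real_derivative X w powr s * ln (X w)) (at s)"
        using X_nonneg[of w] by (cases "X w = 0") (auto intro!: derivative_eq_intros)
      then have "((\<lambda>u. (X w powr u - X w powr s) / (u - s)) \<longlongrightarrow> X w powr s * ln (X w)) (at s)"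
        by (simp add: has_field_derivative_iff)
      then have "(\<lambda>n. (X w powr t n - X w powr s) / (t n - s)) \<longlonglongrightarrow> X w powr s * ln (X w)"
        using t(1,3) unfolding tendsto_at_iff_sequentially comp_def by simp
      then have "(\<lambda>n. q (t n) w) \<longlonglongrightarrow> X w powr s * ln (X w) * ln (X w) ^ k"
        unfolding q_def by (intro tendsto_mult_right)
      then show "(\<lambda>n. q (t n) w) \<longlonglongrightarrow> X w powr s * ln (X w) ^ Suc k"
        by (simp add: mult.assoc)
    qed
    show "AE w in M. norm (q (t n) w)
        \<le> (real (Suc (Suc k)) / d) ^ Suc k * (X w powr a + X w powr b)" for n
    proof (intro AE_I2)
      fix w
      obtain c where c: "min s (t n) \<le> c" "c \<le> max s (t n)"
        "(X w powr t n - X w powr s) / (t n - s) = X w powr c * ln (X w)"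
        using powr_difference_quotient[of "X w" s "t n"] X_nonneg t(1)[of n] by metis
      have "norm (q (t n) w) = X w powr c * \<bar>ln (X w)\<bar> ^ Suc k"
        unfolding q_def c(3) by (simp add: abs_mult power_abs)
      also have "\<dots> \<le> (real (Suc (Suc k)) / d) ^ Suc k * (X w powr a + X w powr b)"
        using c(1,2) t(2)[of n] d X_nonneg by (intro powr_mult_ln_power_bound) auto
      finally show "norm (q (t n) w)
        \<le> (real (Suc (Suc k)) / d) ^ Suc k * (X w powr a + X w powr b)" .
    qed
  qed (auto simp: q_def)
  have eq: "(log_moment M X k t - log_moment M X k s) / (t - s) = (\<integral>w. q t w \<partial>M)"
    if "\<bar>t - s\<bar> \<le> d" for t
  proof -
    have "a < t" "t < b" using that d by auto
    then show ?thesis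
      unfolding log_moment_def q_def
      using integrable_log_moment[of t k] integrable_log_moment[OF assms, of k]
      by (simp add: diff_divide_distrib left_diff_distrib)
  qed
  show ?thesis
    unfolding has_field_derivative_iff
  proof (subst tendsto_cong)
    have "eventually (\<lambda>t. \<bar>t - s\<bar> \<le> d) (at s)"
      using d by (auto simp: eventually_at dist_real_def intro!: exI[of _ d])
    then show "eventually (\<lambda>t. (log_moment M X k t - log_moment M X k s) / (t - s)
        = (\<integral>w. q t w \<partial>M)) (at s)"
      by eventually_elim (rule eq)
    have "((\<lambda>t. \<integral>w. q t w \<partial>M) \<longlongrightarrow> log_moment M X (Suc k) s) (at s within {s - d..s + d})"
      unfolding tendsto_at_iff_sequentially comp_def
      by (intro allI impI quot) (auto simp: abs_le_iff algebra_simps)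
    then show "((\<lambda>t. \<integral>w. q t w \<partial>M) \<longlongrightarrow> log_moment M X (Suc k) s) (at s)"
      using d by (subst (asm) at_within_interior) auto
  qed
qed

lemma isCont_log_moment:
  assumes "a < s" "s < b"
  shows "isCont (log_moment M X k) s"
  using has_real_derivative_log_moment[OF assms] by (rule DERIV_isCont)

text \<open>
  For \<open>m = E[X^s]\<close> and \<open>Z = X^s / m\<close> the difference of the two sides is \<open>m * E[Z * ln Z]\<close>, that is \<open>m\<close> times
  the relative entropy of the law reweighted by \<open>Z\<close>. It is nonnegative as \<open>Z * ln Z \<ge> Z - 1\<close> and
  \<open>E[Z] = 1\<close>.
\<close>
lemma relative_entropy_nonneg:
  assumes "a < s" "s < b" "prob_space M" and pos: "0 < log_moment M X 0 s"
  shows "log_moment M X 0 s * ln (log_moment M X 0 s) \<le> s * log_moment M X 1 s"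
proof -
  interpret prob_space M by fact
  define m where "m = log_moment M X 0 s"
  have m: "0 < m" "m = (\<integral>w. X w powr s \<partial>M)" using pos by (auto simp: m_def log_moment_def)
  have int: "integrable M (\<lambda>w. X w powr s * ln (X w))" "integrable M (\<lambda>w. X w powr s)"
    using integrable_log_moment[OF assms(1,2), of 1] integrable_powr[OF assms(1,2)] by auto
  have "(\<integral>w. X w powr s - m \<partial>M) \<le> (\<integral>w. s * (X w powr s * ln (X w)) - ln m * X w powr s \<partial>M)"
  proof (rule integral_mono)
    fix w
    show "X w powr s - m \<le> s * (X w powr s * ln (X w)) - ln m * X w powr s"
    proof (cases "X w = 0")
      case False
      then have x: "0 < X w" using X_nonneg[of w] by simp
      define z where "z = X w powr s"
      have z: "0 < z" "ln z = s * ln (X w)" using x by (auto simp: z_def ln_powr)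
      have "ln (m / z) \<le> m / z - 1" using m z by (intro ln_le_minus_one) simp
      then have "z * (ln m - ln z) \<le> z * (m / z - 1)"
        using m z by (intro mult_left_mono) (auto simp: ln_div)
      then show ?thesis using z by (simp add: z_def[symmetric] algebra_simps)
    qed (use m in simp)
  qed (use int in auto)
  then show ?thesis
    using int by (simp add: m(2)[symmetric] m_def[symmetric] prob_space)
      (simp add: m_def log_moment_def mult.commute)
qed

end

section \<open>Integrating the derivative of a quotient\<close>

lemma tendsto_quotient_at_zero:
  fixes z :: "real \<Rightarrow> real"
  assumes "(z has_real_derivative d) (at 0 within S)" "z 0 = 0"
  shows "((\<lambda>s. z s / s) \<longlongrightarrow> d) (at 0 within S)"
  using assms by (simp add: has_field_derivative_iff)

text \<open>
  The integrand is the derivative of \<open>z s / s\<close>. It may be unbounded near 0; the sign hypothesis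
  makes the quotient monotone, and the integral of the absolute value is then
  controlled by the limits at the two ends. That hypothesis says that the tangent at \<open>s\<close> lies above
  the graph at 0, as it does for concave \<open>z\<close>.
\<close>
lemma integral_deriv_quotient:
  fixes z z' :: "real \<Rightarrow> real"
  assumes z0: "z 0 = 0" and d: "(z has_real_derivative d) (at 0 within closed_segment 0 p)"
    and der: "\<And>s. s \<in> closed_segment 0 p \<Longrightarrow> s \<noteq> 0 \<Longrightarrow> (z has_real_derivative z' s) (at s)"
    and cont: "\<And>s. s \<in> closed_segment 0 p \<Longrightarrow> s \<noteq> 0 \<Longrightarrow> isCont z' s"
    and conc: "\<And>s. s \<in> closed_segment 0 p \<Longrightarrow> s \<noteq> 0 \<Longrightarrow> s * z' s \<le> z s"
    and p: "p \<noteq> 0"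
  shows "interval_lebesgue_integrable lborel 0 (ereal p) (\<lambda>s. (s * z' s - z s) / s\<^sup>2)"
    and "(LBINT s=0..ereal p. (s * z' s - z s) / s\<^sup>2) = z p / p - d"
proof -
  define f where "f s = - ((s * z' s - z s) / s\<^sup>2)" for s
  define F where "F s = - (z s / s)" for s
  have F: "DERIV F s :> f s" if "s \<in> closed_segment 0 p" "s \<noteq> 0" for s
    unfolding F_def f_def using that
    by (auto intro!: derivative_eq_intros der simp: field_simps power2_eq_square)
  have f: "isCont f s" if "s \<in> closed_segment 0 p" "s \<noteq> 0" for s
    unfolding f_def using that DERIV_isCont[OF der] by (intro continuous_intros cont) auto
  have nonneg: "0 \<le> f s" if "s \<in> closed_segment 0 p" "s \<noteq> 0" for s
    using conc[OF that] unfolding f_def by (simp add: divide_nonpos_nonneg)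
  have F0: "(F \<longlongrightarrow> - d) (at 0 within closed_segment 0 p)"
    unfolding F_def by (intro tendsto_minus tendsto_quotient_at_zero d z0)
  have Fp: "(F \<longlongrightarrow> - (z p / p)) (at p within S)" for S
  proof -
    have "isCont F p" using F[of p] p by (auto intro: DERIV_isCont)
    then have "(F \<longlongrightarrow> F p) (at p)" by (simp add: isCont_def)
    then show ?thesis unfolding F_def by (rule tendsto_within_subset) simp
  qed
  have fint: "interval_lebesgue_integrable lborel 0 (ereal p) f \<and>
      (LBINT s=0..ereal p. f s) = d - z p / p"
  proof (cases "0 < p")
    case True
    have seg: "s \<in> closed_segment 0 p" "s \<noteq> 0" if "0 < ereal s" "ereal s < ereal p" for s
      using that by (auto simp: closed_segment_eq_real_ivl)
    have "at 0 within closed_segment 0 p = at_right 0"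
      using True by (simp add: closed_segment_eq_real_ivl at_within_Icc_at_right)
    then have lim: "((F \<circ> real_of_ereal) \<longlongrightarrow> - d) (at_right 0)"
      "((F \<circ> real_of_ereal) \<longlongrightarrow> - (z p / p)) (at_left (ereal p))"
      using F0 Fp by (simp_all add: ereal_tendsto_simps zero_ereal_def)
    have "0 < ereal p" using True by simp
    note FTC = interval_integral_FTC_nonneg[OF this F[OF seg] f[OF seg] _ lim]
    show ?thesis
      using FTC nonneg[OF seg] True by (simp add: interval_lebesgue_integrable_def)
  next
    case False
    then have neg: "p < 0" using p by simp
    have seg: "s \<in> closed_segment 0 p" "s \<noteq> 0" if "ereal p < ereal s" "ereal s < 0" for s
      using that by (auto simp: closed_segment_eq_real_ivl)
    have "at 0 within closed_segment 0 p = at_left 0"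
      using neg by (simp add: closed_segment_eq_real_ivl at_within_Icc_at_left)
    then have lim: "((F \<circ> real_of_ereal) \<longlongrightarrow> - (z p / p)) (at_right (ereal p))"
      "((F \<circ> real_of_ereal) \<longlongrightarrow> - d) (at_left 0)"
      using F0 Fp by (simp_all add: ereal_tendsto_simps zero_ereal_def)
    have "ereal p < 0" using neg by simp
    note FTC = interval_integral_FTC_nonneg[OF this F[OF seg] f[OF seg] _ lim]
    show ?thesis
      using FTC nonneg[OF seg] neg
      by (subst interval_integral_endpoints_reverse) (simp add: interval_lebesgue_integrable_def)
  qed
  have "interval_lebesgue_integrable lborel 0 (ereal p) (\<lambda>s. (-1) * f s)"
    using fint by (intro interval_lebesgue_integrable_mult_right) blast
  then show "interval_lebesgue_integrable lborel 0 (ereal p) (\<lambda>s. (s * z' s - z s) / s\<^sup>2)"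
    unfolding f_def by (simp only: mult_minus1 minus_minus)
  have "(LBINT s=0..ereal p. - f s) = z p / p - d"
    using fint by (simp add: interval_lebesgue_integral_uminus)
  then show "(LBINT s=0..ereal p. (s * z' s - z s) / s\<^sup>2) = z p / p - d"
    unfolding f_def by (simp only: minus_minus)
qed

section \<open>The scaling exponents\<close>

lemma zeta_dom_iff: "s \<in> zeta_dom M du l \<longleftrightarrow> moment M du s \<noteq> 0 \<and> moment M du s \<noteq> \<infinity>"
  by (simp add: zeta_dom_def ezeta_def elog_def)

lemma zeta_eq_log:
  assumes "moment M du s = ennreal m" "0 < m"
  shows "zeta M du l s = log l m"
  using assms by (simp add: zeta_def ezeta_def elog_def)

lemma moment_0:
  assumes "prob_space M"
  shows "moment M du 0 = 1"
  using prob_space.emeasure_space_1[OF assms] by (simp add: moment_def epow_def)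

lemma zeta_0:
  assumes "prob_space M"
  shows "zeta M du l 0 = 0"
  using zeta_eq_log[of M du 0 1 l] moment_0[OF assms, of du] by simp

lemma AE_nonzero_if_negative_moment:
  assumes [measurable]: "du \<in> borel_measurable M"
    and "s < 0" "moment M du s \<noteq> \<infinity>"
  shows "AE w in M. norm (du w) \<noteq> 0"
proof -
  have meas: "(\<lambda>w. epow (norm (du w)) s) \<in> borel_measurable M"
    unfolding epow_def by measurable
  have "AE w in M. epow (norm (du w)) s \<noteq> \<infinity>"
    using assms(3) by (intro nn_integral_PInf_AE meas) (simp add: moment_def)
  then show ?thesis
    by eventually_elim (use \<open>s < 0\<close> in \<open>auto simp: epow_def\<close>)
qed

text \<open>
  The two powers differ only at 0, and there only for exponents \<open>s \<le> 0\<close>. A finite moment of some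
  negative order \<open>a\<close> makes that a null set.
\<close>
lemma AE_epow_eq_powr:
  assumes "du \<in> borel_measurable M"
    and "0 < s \<or> (a < 0 \<and> moment M du a \<noteq> \<infinity>)"
  shows "AE w in M. epow (norm (du w)) s = ennreal (norm (du w) powr s)"
proof (cases "0 < s")
  case False
  then have "AE w in M. norm (du w) \<noteq> 0"
    using assms AE_nonzero_if_negative_moment by blast
  then show ?thesis
    by eventually_elim (auto simp: epow_def)
qed (simp add: epow_def)

lemma moment_eq_nn_integral_powr:
  assumes "du \<in> borel_measurable M"
    and "0 < s \<or> (a < 0 \<and> moment M du a \<noteq> \<infinity>)"
  shows "moment M du s = (\<integral>\<^sup>+w. ennreal (norm (du w) powr s) \<partial>M)"
  unfolding moment_def by (intro nn_integral_cong_AE AE_epow_eq_powr[OF assms])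

text \<open>
  Exponents \<open>a \<le> 0 \<le> b\<close> in the domain, not both 0. One of them may be 0, which covers the case that
  0 is an endpoint of the domain: then \<open>{a<..<b}\<close> lies on one side of 0.
\<close>
locale increment_moments =
  fixes M :: "'a measure" and du :: "'a \<Rightarrow> 'v::real_normed_vector" and l a b :: real
  assumes prob: "prob_space M"
    and du_measurable [measurable]: "du \<in> borel_measurable M"
    and l: "0 < l" "l < 1"
    and a: "a \<in> zeta_dom M du l" "a \<le> 0"
    and b: "b \<in> zeta_dom M du l" "0 \<le> b"
    and ab: "a < b"
begin

abbreviation X :: "'a \<Rightarrow> real" where "X w \<equiv> norm (du w)"

lemma integrable_X_powr:
  assumes "s \<in> zeta_dom M du l"
  shows "integrable M (\<lambda>w. X w powr s)"
proof (cases "s = 0")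
  case True
  interpret prob_space M by (rule prob)
  show ?thesis
    by (rule integrable_const_bound[where B = 1]) (auto simp: True powr_def)
next
  case False
  have "moment M du s \<noteq> \<infinity>" using assms by (simp add: zeta_dom_iff)
  then have "(\<integral>\<^sup>+w. ennreal (X w powr s) \<partial>M) \<noteq> \<infinity>"
    using moment_eq_nn_integral_powr[of du M s s] False
    by (cases s "0 :: real" rule: linorder_cases) auto
  then show ?thesis
    by (intro integrableI_bounded) (simp_all add: less_top)
qed

sublocale moments M X a b
  by unfold_locales (use a b in \<open>auto intro: integrable_X_powr\<close>)

lemma not_AE_zero: "\<not> (AE w in M. X w = 0)"
proof
  assume zero: "AE w in M. X w = 0"
  interpret prob_space M by (rule prob)
  have "moment M du b = 0" if "0 < b"
  proof -
    have "moment M du b = (\<integral>\<^sup>+w. 0 \<partial>M)"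
      unfolding moment_def
      by (rule nn_integral_cong_AE, use zero in eventually_elim) (use that in \<open>simp add: epow_def\<close>)
    then show ?thesis by simp
  qed
  moreover have "AE w in M. False" if "a < 0"
  proof -
    have "AE w in M. X w \<noteq> 0"
      using a that by (intro AE_nonzero_if_negative_moment[of _ _ a]) (auto simp: zeta_dom_iff)
    with zero show ?thesis by eventually_elim simp
  qed
  moreover have "0 < b \<or> a < 0" using a b ab by linarith
  ultimately show False using b by (auto simp: zeta_dom_iff AE_False)
qed

lemma log_moment_pos:
  assumes "a < s" "s < b"
  shows "0 < log_moment M X 0 s"
proof -
  have "0 \<le> log_moment M X 0 s"
    by (simp add: log_moment_def)
  moreover have "log_moment M X 0 s \<noteq> 0"
    using integral_nonneg_eq_0_iff_AE[OF integrable_powr[OF assms]] not_AE_zero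
    by (simp add: log_moment_def)
  ultimately show ?thesis by simp
qed

lemma moment_eq_log_moment:
  assumes "a < s" "s < b" "s \<noteq> 0 \<or> a < 0"
  shows "moment M du s = ennreal (log_moment M X 0 s)"
proof -
  have "moment M du s = (\<integral>\<^sup>+w. ennreal (X w powr s) \<partial>M)"
    using assms a by (intro moment_eq_nn_integral_powr[where a = a]) (auto simp: zeta_dom_iff)
  also have "\<dots> = ennreal (log_moment M X 0 s)"
    using nn_integral_eq_integral[OF integrable_powr[OF assms(1,2)]] by (simp add: log_moment_def)
  finally show ?thesis .
qed

lemma zeta_eq:
  assumes "a < s" "s < b" "s \<noteq> 0 \<or> a < 0"
  shows "zeta M du l s = ln (log_moment M X 0 s) / ln l"
  using zeta_eq_log[OF moment_eq_log_moment log_moment_pos] assms by (simp add: log_def)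

lemma interior_subset_zeta_dom: "{a<..<b} \<subseteq> zeta_dom M du l"
proof
  fix s assume s: "s \<in> {a<..<b}"
  show "s \<in> zeta_dom M du l"
  proof (cases "s = 0")
    case True
    then show ?thesis by (simp add: zeta_dom_iff moment_0[OF prob])
  next
    case False
    then show ?thesis
      using s moment_eq_log_moment[of s] log_moment_pos[of s] by (simp add: zeta_dom_iff)
  qed
qed

lemma at_within_zeta_dom:
  assumes "a < s" "s < b"
  shows "at s within zeta_dom M du l = at s"
  using interior_subset_zeta_dom assms
  by (intro at_within_interior interiorI[of "{a<..<b}"]) auto

abbreviation dzeta :: "real \<Rightarrow> real" where
  "dzeta s \<equiv> log_moment M X 1 s / (log_moment M X 0 s * ln l)"

lemma has_derivative_zeta:
  assumes "a < s" "s < b" "s \<noteq> 0 \<or> a < 0"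
  shows "(zeta M du l has_real_derivative dzeta s) (at s)"
proof (rule has_field_derivative_transform_within_open)
  define U where "U = {a<..<b} - (if a < 0 then {} else {0})"
  show "open U" unfolding U_def by (intro open_Diff) auto
  show "s \<in> U" using assms by (auto simp: U_def)
  show "ln (log_moment M X 0 t) / ln l = zeta M du l t" if "t \<in> U" for t
    using that by (subst zeta_eq) (auto simp: U_def split: if_splits)
  show "((\<lambda>t. ln (log_moment M X 0 t) / ln l) has_real_derivative dzeta s) (at s)"
    using has_real_derivative_log_moment[OF assms(1,2), of 0] log_moment_pos[OF assms(1,2)] l
    by (auto intro!: derivative_eq_intros simp: field_simps)
qed

lemma zeta'_eq:
  assumes "a < s" "s < b" "s \<noteq> 0 \<or> a < 0"
  shows "zeta' M du l s = dzeta s"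
  unfolding zeta'_def at_within_zeta_dom[OF assms(1,2)]
  using has_derivative_zeta[OF assms]
  by (intro vector_derivative_at) (simp add: has_real_derivative_iff_has_vector_derivative)

lemma isCont_zeta':
  assumes "a < s" "s < b" "s \<noteq> 0"
  shows "isCont (zeta' M du l) s"
proof -
  have "isCont dzeta s"
    using log_moment_pos[OF assms(1,2)] l
    by (intro continuous_intros isCont_log_moment assms) auto
  moreover have "eventually (\<lambda>t. t \<in> {a<..<b} - {0}) (nhds s)"
    using assms by (intro eventually_nhds_in_open open_Diff) auto
  then have "eventually (\<lambda>t. zeta' M du l t = dzeta t) (nhds s)"
    by eventually_elim (rule zeta'_eq, auto)
  ultimately show ?thesis by (subst isCont_cong)
qed

text \<open>Nonnegativity of the relative entropy; dividing by \<open>ln l < 0\<close> reverses the inequality.\<close>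
lemma mult_zeta'_le_zeta:
  assumes "a < s" "s < b" "s \<noteq> 0"
  shows "s * zeta' M du l s \<le> zeta M du l s"
proof -
  define m where "m = log_moment M X 0 s"
  have m: "0 < m" using log_moment_pos[OF assms(1,2)] by (simp add: m_def)
  have "m * ln m \<le> s * log_moment M X 1 s"
    using relative_entropy_nonneg[OF assms(1,2) prob] m by (simp add: m_def)
  then have "ln m \<le> s * log_moment M X 1 s / m"
    using m by (simp add: field_simps)
  moreover have "ln l < 0" using l by simp
  ultimately have "s * log_moment M X 1 s / m / ln l \<le> ln m / ln l"
    by (intro divide_right_mono_neg) auto
  then show ?thesis
    using zeta'_eq[of s] zeta_eq[of s] assms by (simp add: m_def[symmetric])
qed

lemma closed_segment_subset_zeta_dom:
  assumes "a < p" "p < b"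
  shows "closed_segment 0 p \<subseteq> zeta_dom M du l"
proof
  fix s assume "s \<in> closed_segment 0 p"
  then have "s = 0 \<or> s \<in> {a<..<b}"
    using assms a b by (auto simp: closed_segment_eq_real_ivl split: if_splits)
  then show "s \<in> zeta_dom M du l"
    using interior_subset_zeta_dom by (auto simp: zeta_dom_iff moment_0[OF prob])
qed

text \<open>
  Differentiability at 0 is asked for within the domain and used within the segment
  from 0 to \<open>p\<close>, so that 0 may be an interior point or an endpoint of the domain.
\<close>
lemma zeta_representation:
  assumes p: "a < p" "p < b" "p \<noteq> 0"
    and diff: "zeta M du l differentiable (at 0 within zeta_dom M du l)"
  shows "interval_lebesgue_integrable lborel 0 (ereal p) (\<lambda>s. (D M du l s - 3) / s\<^sup>2)"
    and "zeta M du l p = p * zeta' M du l 0 + p * (LBINT s=0..ereal p. (D M du l s - 3) / s\<^sup>2)"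
proof -
  have inside: "a < s \<and> s < b" if "s \<in> closed_segment 0 p" "s \<noteq> 0" for s
    using that p a b by (auto simp: closed_segment_eq_real_ivl split: if_splits)
  have "(zeta M du l has_real_derivative zeta' M du l 0) (at 0 within zeta_dom M du l)"
    using diff vector_derivative_works[of "zeta M du l"]
    by (simp add: zeta'_def has_real_derivative_iff_has_vector_derivative)
  then have at0: "(zeta M du l has_real_derivative zeta' M du l 0) (at 0 within closed_segment 0 p)"
    by (rule has_field_derivative_subset) (rule closed_segment_subset_zeta_dom[OF p(1,2)])
  have der: "(zeta M du l has_real_derivative zeta' M du l s) (at s)"
    if "s \<in> closed_segment 0 p" "s \<noteq> 0" for s
    using has_derivative_zeta[of s] zeta'_eq[of s] inside[OF that] that by simp
  have integrand: "(D M du l s - 3) / s\<^sup>2 = (s * zeta' M du l s - zeta M du l s) / s\<^sup>2" for s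
    by (simp add: D_def)
  note quotient = integral_deriv_quotient[OF zeta_0[OF prob] at0 der isCont_zeta' mult_zeta'_le_zeta p(3)]
  show "interval_lebesgue_integrable lborel 0 (ereal p) (\<lambda>s. (D M du l s - 3) / s\<^sup>2)"
    unfolding integrand using inside by (intro quotient(1)) auto
  have "(LBINT s=0..ereal p. (D M du l s - 3) / s\<^sup>2) = zeta M du l p / p - zeta' M du l 0"
    unfolding integrand using inside by (intro quotient(2)) auto
  then show "zeta M du l p = p * zeta' M du l 0 + p * (LBINT s=0..ereal p. (D M du l s - 3) / s\<^sup>2)"
    using p by (simp add: field_simps)
qed

end

(* zeta' at 0 is part of the claim, so it has to exist.  It does when p_min < 0 < p_max; the
   differentiability assumption only concerns the case that 0 is p_min or p_max, where zeta' at 0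
   is one-sided and may fail to be finite. *)
theorem mainTheorem2:
  fixes M :: "'a measure" and du :: "'a \<Rightarrow> 'v::real_normed_vector" and l p :: real
  assumes "prob_space M"
    and "du \<in> borel_measurable M"
    and "0 < l" and "l < 1"
    and "\<not> (p_min M du l < 0 \<and> 0 < p_max M du l) \<Longrightarrow>
           zeta M du l differentiable (at 0 within zeta_dom M du l)"
    and "p_min M du l < ereal p" and "ereal p < p_max M du l"
  shows "interval_lebesgue_integrable lborel 0 (ereal p) (\<lambda>s. (D M du l s - 3) / s\<^sup>2) \<and>
         zeta M du l p =
           p * zeta' M du l 0 + p * (LBINT s=0..ereal p. (D M du l s - 3) / s\<^sup>2)"
proof (cases "p = 0")
  case True
  then show ?thesis
    using zeta_0[OF assms(1), of du l]
    by (simp add: interval_lebesgue_integrable_def set_integrable_def zero_ereal_def)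
next
  case False
  have lower: "\<exists>a \<in> zeta_dom M du l. a \<le> 0 \<and> a < q" if "p_min M du l < ereal q" for q
    using that unfolding p_min_def Inf_less_iff by auto
  have upper: "\<exists>b \<in> zeta_dom M du l. 0 \<le> b \<and> q < b" if "ereal q < p_max M du l" for q
    using that unfolding p_max_def less_Sup_iff by auto
  have locale_of: "increment_moments M du l a b"
    if "a \<in> zeta_dom M du l" "a \<le> 0" "b \<in> zeta_dom M du l" "0 \<le> b" "a < b" for a b
    using that assms by (simp add: increment_moments_def)
  have diff: "zeta M du l differentiable (at 0 within zeta_dom M du l)"
  proof (cases "p_min M du l < 0 \<and> 0 < p_max M du l")
    case True
    obtain a where lo: "a \<in> zeta_dom M du l" "a < 0"
      using lower[of 0] True by (auto simp: zero_ereal_def)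
    obtain b where hi: "b \<in> zeta_dom M du l" "0 < b"
      using upper[of 0] True by (auto simp: zero_ereal_def)
    interpret increment_moments M du l a b using lo hi by (intro locale_of) auto
    have "(zeta M du l has_real_derivative dzeta 0) (at 0)"
      using lo hi by (intro has_derivative_zeta) auto
    then show ?thesis
      using lo hi at_within_zeta_dom[of 0] by (auto simp: real_differentiable_def)
  qed (rule assms(5))
  \<comment> \<open>Here 0 may be an endpoint of the domain, so \<open>a\<close> or \<open>b\<close> may have to be 0.\<close>
  obtain a where lo: "a \<in> zeta_dom M du l" "a \<le> 0" "a < p"
    using lower[OF assms(6)] by blast
  obtain b where hi: "b \<in> zeta_dom M du l" "0 \<le> b" "p < b"
    using upper[OF assms(7)] by blast
  interpret increment_moments M du l a b using lo hi by (intro locale_of) auto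
  show ?thesis using zeta_representation[OF lo(3) hi(3) False diff] by blast
qed

end
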